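(* For every total function $g:\{0,1\}^m \to \{0,1\}$ and every $\epsilon:\mathbb{N} \to (0, 1/2)$, \[\mathsf{R}^{\mathsf{prod}}(g)=\widetilde{O}\left(\frac{1}{\epsilon(m)}\cdot\mathsf{R}^{\mathsf{prod}}_{\frac{1}{2}-\epsilon(m)}(g)\right).\]
   Context: A deterministic decision tree on $m$ variables adaptively queries variables of $x\in\{0,1\}^m$; each leaf $\ell$ corresponds to the subcube $\ell\subseteq\{0,1\}^m$ of inputs reaching it. A randomized decision tree is a probability distribution over deterministic decision trees (leaves may be unlabelled); its query complexity is the maximum depth of a tree in its support. A product distribution $\mu$ on $\{0,1\}^m$ is one under which the bits are independent; $\mathsf{PROD}$ is the set of them. For a tree $T$ and $\mu$, let $p^\mu_\ell$ be the probability that $T$ on $x\sim\mu$ reaches leaf $\ell$, and $\mathbf{p}^\mu=(p^\mu_\ell)_\ell$; $\mu|_\ell$ is $\mu$ conditioned on $x\in\ell$. A randomized decision tree $\mathcal{R}$ computes $g$ with error $\epsilon$ for product distributions if for every $\mu\in\mathsf{PROD}$, $\mathbf{E}_{T\sim\mathcal{R}}\mathbf{E}_{\ell\sim\mathbf{p}^\mu}[\min\{\Pr_{x\sim\mu|_\ell}[g(x)=0],\Pr_{x\sim\mu|_\ell}[g(x)=1]\}]\le\epsilon$ (the min taken as $0$ when $p^\mu_\ell=0$). $\mathsf{R}^{\mathsf{prod}}_\epsilon(g)$ is the minimum query complexity of such $\mathcal{R}$, and $\mathsf{R}^{\mathsf{prod}}(g):=\mathsf{R}^{\mathsf{prod}}_{1/3}(g)$.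 $\widetilde{O}$ hides polylogarithmic factors. *)

theory Defs
  imports "HOL-Probability.Probability"
begin

text \<open>A point of \<open>{0,1}\<^sup>m\<close> is a function on \<^typ>\<open>nat\<close> that is \<open>False\<close> from index \<open>m\<close> on
  (the encoding used by \<^const>\<open>Pi_pmf\<close>).  Boolean functions on the cube are represented by
  functions on the whole type; their values off the cube never matter.\<close>

definition cube :: "nat \<Rightarrow> (nat \<Rightarrow> bool) set" where
  "cube m = PiE_dflt {..<m} False (\<lambda>_. UNIV)"

definition prod_dists :: "nat \<Rightarrow> (nat \<Rightarrow> bool) pmf set" where
  "prod_dists m = {\<mu>. set_pmf \<mu> \<subseteq> cube m \<and>
     prob_space.indep_vars (measure_pmf \<mu>) (\<lambda>_. count_space UNIV) (\<lambda>i x. x i) {..<m}}"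

text \<open>In \<open>Query i T\<^sub>0 T\<^sub>1\<close> the subtree \<open>T\<^sub>0\<close> is entered when \<open>x i\<close> is \<open>False\<close>, \<open>T\<^sub>1\<close> when it is
  \<open>True\<close>.\<close>

datatype dtree = Leaf | Query nat dtree dtree

fun queried_vars :: "dtree \<Rightarrow> nat set" where
  "queried_vars Leaf = {}"
| "queried_vars (Query i T\<^sub>0 T\<^sub>1) = insert i (queried_vars T\<^sub>0 \<union> queried_vars T\<^sub>1)"

fun depth :: "dtree \<Rightarrow> nat" where
  "depth Leaf = 0"
| "depth (Query i T\<^sub>0 T\<^sub>1) = Suc (max (depth T\<^sub>0) (depth T\<^sub>1))"

fun leaves_within :: "(nat \<Rightarrow> bool) set \<Rightarrow> dtree \<Rightarrow> (nat \<Rightarrow> bool) set set" where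
  "leaves_within S Leaf = {S}"
| "leaves_within S (Query i T\<^sub>0 T\<^sub>1) =
     leaves_within (S \<inter> {x. \<not> x i}) T\<^sub>0 \<union> leaves_within (S \<inter> {x. x i}) T\<^sub>1"

text \<open>Leaves are identified with the sets of inputs reaching them.  Distinct leaves get disjoint
  sets, so two leaves can be identified only if no input reaches either of them, which can happen
  when a variable is queried repeatedly; such leaves have probability 0.\<close>

definition leaves :: "nat \<Rightarrow> dtree \<Rightarrow> (nat \<Rightarrow> bool) set set" where
  "leaves m T = leaves_within (cube m) T"

definition leaf_error :: "((nat \<Rightarrow> bool) \<Rightarrow> bool) \<Rightarrow> (nat \<Rightarrow> bool) pmf \<Rightarrow> (nat \<Rightarrow> bool) set \<Rightarrow> real" where
  "leaf_error g \<mu> l =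
     (if measure_pmf.prob \<mu> l = 0 then 0
      else min (measure_pmf.prob (cond_pmf \<mu> l) {x. \<not> g x})
               (measure_pmf.prob (cond_pmf \<mu> l) {x. g x}))"

definition tree_error :: "nat \<Rightarrow> ((nat \<Rightarrow> bool) \<Rightarrow> bool) \<Rightarrow> (nat \<Rightarrow> bool) pmf \<Rightarrow> dtree \<Rightarrow> real" where
  "tree_error m g \<mu> T = (\<Sum>l\<in>leaves m T. measure_pmf.prob \<mu> l * leaf_error g \<mu> l)"

text \<open>Finiteness of the set of depths makes the maximum depth exist.\<close>

definition randomized_dtree :: "nat \<Rightarrow> dtree pmf \<Rightarrow> bool" where
  "randomized_dtree m R \<longleftrightarrow>
     (\<forall>T\<in>set_pmf R. queried_vars T \<subseteq> {..<m}) \<and> finite (depth ` set_pmf R)"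

definition query_complexity :: "dtree pmf \<Rightarrow> nat" where
  "query_complexity R = Max (depth ` set_pmf R)"

definition computes_prod :: "nat \<Rightarrow> real \<Rightarrow> ((nat \<Rightarrow> bool) \<Rightarrow> bool) \<Rightarrow> dtree pmf \<Rightarrow> bool" where
  "computes_prod m \<epsilon> g R \<longleftrightarrow>
     (\<forall>\<mu>\<in>prod_dists m. measure_pmf.expectation R (tree_error m g \<mu>) \<le> \<epsilon>)"

definition R_prod_err :: "nat \<Rightarrow> real \<Rightarrow> ((nat \<Rightarrow> bool) \<Rightarrow> bool) \<Rightarrow> nat" where
  "R_prod_err m \<epsilon> g =
     (LEAST d. \<exists>R. randomized_dtree m R \<and> computes_prod m \<epsilon> g R \<and> query_complexity R = d)"

definition R_prod :: "nat \<Rightarrow> ((nat \<Rightarrow> bool) \<Rightarrow> bool) \<Rightarrow> nat" where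
  "R_prod m g = R_prod_err m (1/3) g"

text \<open>\<open>f = O~(h)\<close> means \<open>f = O(h log\<^sup>k h)\<close> for some \<open>k\<close>, with constants uniform over the index
  set \<open>I\<close>.  The shift by 2 only keeps the logarithm at least 1 when \<open>h\<close> is small.\<close>

definition soft_O_on :: "'a set \<Rightarrow> ('a \<Rightarrow> real) \<Rightarrow> ('a \<Rightarrow> real) \<Rightarrow> bool" where
  "soft_O_on I f h \<longleftrightarrow>
     (\<exists>C>0. \<exists>k::nat. \<forall>a\<in>I. \<bar>f a\<bar> \<le> C * (\<bar>h a\<bar> * log 2 (2 + \<bar>h a\<bar>) ^ k))"

end

theory Submission
  imports Defs
begin

text \<open>Let \<open>R\<close> have depth \<open>d\<close> and error \<open>1/2 - \<epsilon>\<close>.  If variable \<open>i\<close> is sensitive at \<open>x\<close>, the uniform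
  distribution on \<open>x\<close> and its neighbour along \<open>i\<close> is a product distribution, and a tree that does not
  query \<open>i\<close> on \<open>x\<close> has error 1/2 on it; hence \<open>R\<close> queries \<open>i\<close> on \<open>x\<close> with probability at least
  \<open>2\<epsilon>\<close>.  Summing over \<open>i\<close>, every \<open>x\<close> has at most \<open>d / (2\<epsilon>)\<close> sensitive variables, and after
  \<open>k = O(log (d / \<epsilon>) / \<epsilon>)\<close> independent runs of \<open>R\<close> the expected number of sensitive variables
  of \<open>x\<close> that remain unqueried is a small constant.  A product distribution conditioned on a leaf is
  again a product distribution, so by the Poincare inequality the error at the leaf is at most
  twice the expected number of unqueried sensitive variables there.\<close>

definition sensitive :: "((nat \<Rightarrow> bool) \<Rightarrow> bool) \<Rightarrow> (nat \<Rightarrow> bool) \<Rightarrow> nat \<Rightarrow> bool" where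
  "sensitive g x i \<longleftrightarrow> g (x(i := \<not> x i)) \<noteq> g x"

fun path_vars :: "dtree \<Rightarrow> (nat \<Rightarrow> bool) \<Rightarrow> nat set" where
  "path_vars Leaf x = {}"
| "path_vars (Query i T\<^sub>0 T\<^sub>1) x = insert i (if x i then path_vars T\<^sub>1 x else path_vars T\<^sub>0 x)"

subsection \<open>A Poincare inequality for product weights\<close>

text \<open>The weights need not be normalised, so restricting a product distribution to a subcube stays
  within this setting without conditioning.\<close>

definition wsum :: "nat set \<Rightarrow> (nat \<Rightarrow> bool \<Rightarrow> real) \<Rightarrow> ((nat \<Rightarrow> bool) \<Rightarrow> real) \<Rightarrow> real" where
  "wsum A W f = (\<Sum>x\<in>PiE_dflt A False (\<lambda>_. UNIV). (\<Prod>i\<in>A. W i (x i)) * f x)"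

lemma wsum_empty: "wsum {} W f = f (\<lambda>_. False)"
proof -
  have "PiE_dflt {} False (\<lambda>_. UNIV) = {\<lambda>_::nat. False}"
    by (auto simp: PiE_dflt_def)
  then show ?thesis
    by (simp add: wsum_def)
qed

text \<open>Fubini in coordinate \<open>i\<close>. Points over \<open>A\<close> have the default
  value \<open>False\<close> at \<open>i\<close>, so overwriting \<open>i\<close> is injective on
  them, and the two images make up the larger cube.\<close>

lemma wsum_insert:
  assumes "finite A" "i \<notin> A"
  shows "wsum (insert i A) W f =
    W i False * wsum A W (\<lambda>x. f (x(i := False))) + W i True * wsum A W (\<lambda>x. f (x(i := True)))"
proof -
  let ?P = "PiE_dflt A False (\<lambda>_. UNIV)"
  have fin: "finite ?P"
    using assms by auto
  have half: "(\<Sum>x\<in>(\<lambda>x. x(i := b)) ` ?P. (\<Prod>j\<in>insert i A. W j (x j)) * f x)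
      = W i b * wsum A W (\<lambda>x. f (x(i := b)))" for b
  proof -
    have inj: "inj_on (\<lambda>x. x(i := b)) ?P"
    proof (rule inj_onI)
      fix x y assume xy: "x \<in> ?P" "y \<in> ?P" "x(i := b) = y(i := b)"
      then have "x i = y i"
        using assms(2) by (auto simp: PiE_dflt_def)
      then show "x = y"
        using fun_cong[OF xy(3)] by (intro ext) (metis fun_upd_other)
    qed
    have "(\<Prod>j\<in>insert i A. W j ((x(i := b)) j)) = W i b * (\<Prod>j\<in>A. W j (x j))" for x
      using assms by (auto intro!: prod.cong)
    then show ?thesis
      by (simp add: sum.reindex[OF inj] wsum_def sum_distrib_left mult.assoc)
  qed
  have "PiE_dflt (insert i A) False (\<lambda>_. UNIV) \<subseteq>
      (\<lambda>x. x(i := False)) ` ?P \<union> (\<lambda>x. x(i := True)) ` ?P"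
  proof
    fix x assume x: "x \<in> PiE_dflt (insert i A) False (\<lambda>_. UNIV)"
    have "x(i := False) \<in> ?P"
      using x by (auto simp: PiE_dflt_def)
    then have "x \<in> (\<lambda>y. y(i := x i)) ` ?P"
      by (rule image_eqI[rotated]) simp
    then show "x \<in> (\<lambda>x. x(i := False)) ` ?P \<union> (\<lambda>x. x(i := True)) ` ?P"
      by (cases "x i") simp_all
  qed
  then have split: "PiE_dflt (insert i A) False (\<lambda>_. UNIV) =
      (\<lambda>x. x(i := False)) ` ?P \<union> (\<lambda>x. x(i := True)) ` ?P"
    by (auto simp: PiE_dflt_def)
  have "wsum (insert i A) W f =
    (\<Sum>x\<in>(\<lambda>x. x(i := False)) ` ?P. (\<Prod>j\<in>insert i A. W j (x j)) * f x) +
    (\<Sum>x\<in>(\<lambda>x. x(i := True)) ` ?P. (\<Prod>j\<in>insert i A. W j (x j)) * f x)"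
    unfolding wsum_def split using fin
    by (subst sum.union_disjoint) (auto dest: fun_cong[where x = i])
  then show ?thesis
    by (simp only: half)
qed

lemma wsum_add: "wsum A W (\<lambda>x. f x + h x) = wsum A W f + wsum A W h"
  by (simp add: wsum_def algebra_simps sum.distrib)

lemma wsum_mono:
  assumes "\<And>i b. 0 \<le> W i b" "\<And>x. f x \<le> h x"
  shows "wsum A W f \<le> wsum A W h"
  unfolding wsum_def by (intro sum_mono mult_left_mono prod_nonneg ballI assms)

lemma wsum_nonneg:
  assumes "\<And>i b. 0 \<le> W i b" "\<And>x. 0 \<le> f x"
  shows "0 \<le> wsum A W f"
  unfolding wsum_def by (intro sum_nonneg mult_nonneg_nonneg prod_nonneg ballI assms)

text \<open>The inductive step of the Poincare inequality in numbers. \<open>u\<close> and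
  \<open>v\<close> weigh the two values of the new coordinate; on the two halves \<open>g\<close>
  has mass \<open>a\<close> and \<open>b\<close> out of the same total \<open>t\<close>,
  \<open>s\<close> is the mass where the halves disagree, and \<open>p\<close>, \<open>q\<close> are
  the influences inside them. The variance is the part within the halves plus
  \<open>u * v * (a - b)\<^sup>2\<close> between them.\<close>

lemma variance_split:
  fixes u v a b t s p q :: real
  assumes "0 \<le> u" "0 \<le> v" "0 \<le> t" "0 \<le> a" "a \<le> t" "0 \<le> b" "b \<le> t"
    and "\<bar>a - b\<bar> \<le> s"
    and "a * (t - a) \<le> t * p" "b * (t - b) \<le> t * q"
  shows "(u * a + v * b) * (u * (t - a) + v * (t - b)) \<le>
    (u * t + v * t) * (of_bool (u * v \<noteq> 0) * (u * s + v * s) + (u * p + v * q))"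
proof -
  have eq: "(u * a + v * b) * (u * (t - a) + v * (t - b)) =
      (u + v) * (u * (a * (t - a)) + v * (b * (t - b))) + u * v * (a - b)\<^sup>2"
    by (simp add: algebra_simps power2_eq_square)
  have 1: "(u + v) * (u * (a * (t - a)) + v * (b * (t - b))) \<le> (u + v) * (u * (t * p) + v * (t * q))"
    using assms by (intro mult_left_mono add_mono) auto
  have "(a - b)\<^sup>2 = \<bar>a - b\<bar> * \<bar>a - b\<bar>"
    by (simp add: power2_eq_square)
  \<comment> \<open>One factor is bounded by \<open>t\<close>, the other by
    \<open>s\<close>.\<close>
  also have "\<dots> \<le> t * s"
    using assms by (intro mult_mono) auto
  finally have "u * v * (a - b)\<^sup>2 \<le> u * v * (t * s)"
    using assms by (intro mult_left_mono) auto
  moreover have "0 \<le> t * s"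
    using assms by (meson abs_ge_zero mult_nonneg_nonneg order_trans)
  \<comment> \<open>Here \<open>u * v\<close> is at most \<open>(u + v) * (u + v)\<close>, and for
    \<open>u * v = 0\<close> both sides vanish; this is how the indicator enters.\<close>
  then have "u * v * (t * s) \<le> of_bool (u * v \<noteq> 0) * ((u + v) * (u + v) * (t * s))"
    using assms by (auto intro!: mult_right_mono simp: algebra_simps)
  ultimately have "u * v * (a - b)\<^sup>2 \<le> of_bool (u * v \<noteq> 0) * ((u + v) * (u + v) * (t * s))"
    by linarith
  with eq 1 show ?thesis
    by (simp add: algebra_simps)
qed

text \<open>Unnormalised variance against total mass times total influence; both sides scale alike.
  The induction splits along the coordinate added last. The indicator drops coordinates whose weight
  sits on at most one value; at a leaf these include the queried variables.\<close>

lemma wsum_poincare: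
  assumes "finite A" and W: "\<And>i b. 0 \<le> W i b"
  shows "wsum A W (\<lambda>x. of_bool (g x)) * wsum A W (\<lambda>x. of_bool (\<not> g x)) \<le>
    wsum A W (\<lambda>_. 1) *
      (\<Sum>i\<in>A. of_bool (W i False * W i True \<noteq> 0) * wsum A W (\<lambda>x. of_bool (sensitive g x i)))"
  using assms(1)
proof (induction A arbitrary: g rule: finite_induct)
  case empty
  then show ?case
    by (simp add: wsum_empty)
next
  case (insert i A)
  define G where "G b x = g (x(i := b))" for b x
  define a where "a b = wsum A W (\<lambda>x. of_bool (G b x))" for b
  define t where "t = wsum A W (\<lambda>_. 1)"
  define s where "s = wsum A W (\<lambda>x. of_bool (G False x \<noteq> G True x))"
  define p where "p b = (\<Sum>j\<in>A. of_bool (W j False * W j True \<noteq> 0) *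
    wsum A W (\<lambda>x. of_bool (sensitive (G b) x j)))" for b
  have "a b + wsum A W (\<lambda>x. of_bool (\<not> G b x)) = t" for b
    unfolding a_def t_def wsum_add[symmetric] by (intro arg_cong[of _ _ "wsum A W"]) auto
  then have compl: "wsum A W (\<lambda>x. of_bool (\<not> G b x)) = t - a b" for b
    by (simp add: algebra_simps)
  have a_bounds: "0 \<le> a b" "a b \<le> t" for b
    unfolding a_def t_def by (auto intro!: wsum_nonneg wsum_mono W)
  have "a False \<le> a True + s" "a True \<le> a False + s"
    unfolding a_def s_def wsum_add[symmetric] by (auto intro!: wsum_mono W)
  then have s: "\<bar>a False - a True\<bar> \<le> s"
    by simp
  have IH: "a b * (t - a b) \<le> t * p b" for b
    using insert.IH[of "G b"] compl[of b] by (simp add: a_def t_def p_def)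
  \<comment> \<open>Flipping \<open>i\<close> exchanges the two restrictions of \<open>g\<close>, so
    sensitivity at \<open>i\<close> is their disagreement, in either half. Updates at
    \<open>i\<close> and at another \<open>j\<close> commute, so sensitivity at \<open>j\<close> is
    that of the restriction.\<close>
  have sens_i: "wsum (insert i A) W (\<lambda>x. of_bool (sensitive g x i)) = W i False * s + W i True * s"
    unfolding wsum_insert[OF insert.hyps] s_def G_def sensitive_def by (simp add: eq_commute)
  have sens_j: "wsum (insert i A) W (\<lambda>x. of_bool (sensitive g x j)) =
      W i False * wsum A W (\<lambda>x. of_bool (sensitive (G False) x j)) +
      W i True * wsum A W (\<lambda>x. of_bool (sensitive (G True) x j))" if "j \<in> A" for j
  proof -
    have "j \<noteq> i"
      using that insert.hyps by auto
    then show ?thesis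
      unfolding wsum_insert[OF insert.hyps] G_def sensitive_def by (simp add: fun_upd_twist)
  qed
  have "(\<Sum>j\<in>A. of_bool (W j False * W j True \<noteq> 0) * wsum (insert i A) W (\<lambda>x. of_bool (sensitive g x j)))
      = W i False * p False + W i True * p True"
    unfolding p_def sum_distrib_left sum.distrib[symmetric]
    by (intro sum.cong) (auto simp: sens_j algebra_simps)
  then have rhs: "(\<Sum>j\<in>insert i A. of_bool (W j False * W j True \<noteq> 0) *
        wsum (insert i A) W (\<lambda>x. of_bool (sensitive g x j))) =
      of_bool (W i False * W i True \<noteq> 0) * (W i False * s + W i True * s) +
      (W i False * p False + W i True * p True)"
    using insert.hyps by (simp add: sens_i)
  have lhs: "wsum (insert i A) W (\<lambda>x. of_bool (g x)) = W i False * a False + W i True * a True"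
    "wsum (insert i A) W (\<lambda>x. of_bool (\<not> g x)) = W i False * (t - a False) + W i True * (t - a True)"
    "wsum (insert i A) W (\<lambda>_. 1) = W i False * t + W i True * t"
    unfolding wsum_insert[OF insert.hyps] compl[symmetric] by (simp_all add: a_def G_def t_def)
  have "0 \<le> t"
    using a_bounds order_trans by blast
  then show ?case
    unfolding rhs lhs by (intro variance_split W a_bounds s IH)
qed

subsection \<open>Errors of trees under product distributions\<close>

lemma pmf_prod_dists:
  assumes "\<mu> \<in> prod_dists m" "x \<in> cube m"
  shows "pmf \<mu> x = (\<Prod>i<m. pmf (map_pmf (\<lambda>y. y i) \<mu>) (x i))"
\<comment> \<open>Independence is applied over a nonempty index set; for \<open>m = 0\<close> the
  cube is a single point.\<close>
proof (cases "m = 0")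
  case True
  then have "set_pmf \<mu> \<subseteq> {x}"
    using assms by (auto simp: prod_dists_def cube_def PiE_dflt_def)
  then have "\<mu> = return_pmf x"
    by (simp add: set_pmf_subset_singleton)
  with True show ?thesis
    by simp
next
  case False
  have sub: "set_pmf \<mu> \<subseteq> cube m"
    using assms by (simp add: prod_dists_def)
  have "pmf \<mu> x = measure_pmf.prob \<mu> {x}"
    by (simp add: measure_pmf_single)
  \<comment> \<open>Agreement with \<open>x\<close> below \<open>m\<close> determines a point of the
    cube, whose later entries are all \<open>False\<close>; the two events differ by a null
    set.\<close>
  also have "\<dots> = measure_pmf.prob \<mu> (\<Inter>i\<in>{..<m}. (\<lambda>y. y i) -` {x i} \<inter> space (measure_pmf \<mu>))"
  proof (rule measure_prob_cong_0)
    fix y assume "y \<in> (\<Inter>i\<in>{..<m}. (\<lambda>y. y i) -` {x i} \<inter> space (measure_pmf \<mu>)) - {x}"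
    then have *: "\<forall>i<m. y i = x i" "y \<noteq> x"
      by auto
    then have "y \<notin> cube m"
      using assms(2) by (auto simp: cube_def PiE_dflt_def fun_eq_iff not_less) (metis not_less)+
    with sub show "pmf \<mu> y = 0"
      by (auto simp: set_pmf_iff)
  qed auto
  also have "\<dots> = (\<Prod>i\<in>{..<m}. measure_pmf.prob \<mu> ((\<lambda>y. y i) -` {x i} \<inter> space (measure_pmf \<mu>)))"
    using assms False by (intro prob_space.indep_varsD_finite[OF measure_pmf.prob_space_axioms]) (auto simp: prod_dists_def)
  also have "\<dots> = (\<Prod>i<m. pmf (map_pmf (\<lambda>y. y i) \<mu>) (x i))"
    by (simp add: pmf_map)
  finally show ?thesis .
qed

lemma finite_cube: "finite (cube m)"
  unfolding cube_def by auto

lemma prob_cube_sum: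
  assumes "set_pmf \<mu> \<subseteq> cube m"
  shows "measure_pmf.prob \<mu> S = (\<Sum>x\<in>cube m. pmf \<mu> x * of_bool (x \<in> S))"
proof -
  have "measure_pmf.prob \<mu> S = measure_pmf.prob \<mu> (S \<inter> cube m)"
    using assms by (intro measure_prob_cong_0) (auto simp: set_pmf_iff)
  also have "\<dots> = (\<Sum>x\<in>S \<inter> cube m. pmf \<mu> x)"
    by (intro measure_measure_pmf_finite) (simp add: finite_cube)
  also have "\<dots> = (\<Sum>x\<in>cube m. pmf \<mu> x * of_bool (x \<in> S))"
    using finite_cube by (auto simp: of_bool_def if_distrib sum.If_cases Int_def conj_commute
        intro!: sum.cong cong: if_cong)
  finally show ?thesis .
qed

text \<open>The contribution of a leaf to the error with the conditioning multiplied out, so that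
  leaves of probability 0 are no special case.\<close>

definition leaf_mass :: "((nat \<Rightarrow> bool) \<Rightarrow> bool) \<Rightarrow> (nat \<Rightarrow> bool) pmf \<Rightarrow> (nat \<Rightarrow> bool) set \<Rightarrow> real" where
  "leaf_mass g \<mu> l = min (measure_pmf.prob \<mu> (l \<inter> {x. \<not> g x})) (measure_pmf.prob \<mu> (l \<inter> {x. g x}))"

lemma prob_times_leaf_error: "measure_pmf.prob \<mu> l * leaf_error g \<mu> l = leaf_mass g \<mu> l"
proof (cases "measure_pmf.prob \<mu> l = 0")
  case True
  then have "measure_pmf.prob \<mu> (l \<inter> X) = 0" for X
    by (metis inf_le1 measure_pmf.finite_measure_mono measure_nonneg order_antisym sets_measure_pmf UNIV_I)
  with True show ?thesis
    by (simp add: leaf_mass_def)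
next
  case False
  then have ne: "set_pmf \<mu> \<inter> l \<noteq> {}"
    by (auto simp: measure_pmf_zero_iff)
  have "measure_pmf.prob (cond_pmf \<mu> l) X = measure_pmf.prob \<mu> (l \<inter> X) / measure_pmf.prob \<mu> l" for X
    unfolding cond_pmf.rep_eq[OF ne]
    by (rule measure_uniform_measure) (use False in \<open>auto simp: measure_pmf.emeasure_eq_measure\<close>)
  moreover have "0 < measure_pmf.prob \<mu> l"
    using False by (simp add: zero_less_measure_iff)
  ultimately show ?thesis
    using False by (simp add: leaf_error_def leaf_mass_def min_mult_distrib_left)
qed

lemma tree_error_eq: "tree_error m g \<mu> T = (\<Sum>l\<in>leaves_within (cube m) T. leaf_mass g \<mu> l)"
  by (simp add: tree_error_def leaves_def prob_times_leaf_error)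

lemma leaves_within_subset: "l \<in> leaves_within S T \<Longrightarrow> l \<subseteq> S"
  by (induction T arbitrary: S) auto

lemma finite_leaves_within: "finite (leaves_within S T)"
  by (induction T arbitrary: S) auto

text \<open>The two families of leaves live on disjoint sets, so they can share only the empty leaf,
  where \<open>\<phi>\<close> is 0.\<close>

lemma sum_leaves_within_Query:
  assumes "\<phi> {} = 0"
  shows "sum \<phi> (leaves_within S (Query i T\<^sub>0 T\<^sub>1)) =
    sum \<phi> (leaves_within (S \<inter> {x. \<not> x i}) T\<^sub>0) + sum \<phi> (leaves_within (S \<inter> {x. x i}) T\<^sub>1)"
proof -
  have "l = {}" if "l \<in> leaves_within (S \<inter> {x. \<not> x i}) T\<^sub>0 \<inter> leaves_within (S \<inter> {x. x i}) T\<^sub>1" for l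
    using that by (auto dest!: leaves_within_subset)
  with assms show ?thesis
    by (simp, intro sum.union_inter_neutral finite_leaves_within) auto
qed

lemma leaf_mass_nonneg: "0 \<le> leaf_mass g \<mu> l"
  by (simp add: leaf_mass_def)

lemma leaf_mass_empty: "leaf_mass g \<mu> {} = 0"
  by (simp add: leaf_mass_def)

text \<open>\<open>B i\<close> holds the values still allowed for variable \<open>i\<close>:
  \<open>UNIV\<close> while it is free, a singleton once it is queried, empty after contradictory
  repeated queries.\<close>

definition subcube :: "nat \<Rightarrow> (nat \<Rightarrow> bool set) \<Rightarrow> (nat \<Rightarrow> bool) set" where
  "subcube m B = PiE_dflt {..<m} False B"

text \<open>Since \<open>a + b\<close> is at most twice the maximum,
  \<open>min a b * (a + b)\<close> is at most \<open>2 * (a * b)\<close>; then \<open>a + b\<close>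
  cancels.\<close>

lemma min_le_of_mult_le:
  fixes a b e :: real
  assumes "0 \<le> a" "0 \<le> b" "0 \<le> e" "a * b \<le> (a + b) * e"
  shows "min a b \<le> 2 * e"
proof (cases "a + b = 0")
  case True
  with assms show ?thesis by auto
next
  case False
  have "min a b * (a + b) \<le> 2 * (a * b)"
    using assms(1,2) by (auto simp: min_def algebra_simps intro!: mult_left_mono mult_right_mono)
  also have "\<dots> \<le> (2 * e) * (a + b)"
    using assms(4) by (simp add: algebra_simps)
  finally show ?thesis
    using False assms by (simp add: mult_le_cancel_right)
qed

text \<open>The Poincare inequality for \<open>\<mu>\<close> restricted to the subcube. The masses
  of the two values of \<open>g\<close> add up to the total mass, which cancels.\<close>

lemma leaf_mass_subcube_le:
  assumes "\<mu> \<in> prod_dists m"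
  shows "leaf_mass g \<mu> (subcube m B) \<le>
    2 * (\<Sum>i | i < m \<and> B i = UNIV. measure_pmf.prob \<mu> {x \<in> subcube m B. sensitive g x i})"
proof -
  \<comment> \<open>Marginals cut down to the allowed values: by independence their product is the
    restriction of \<open>\<mu>\<close> to the subcube.\<close>
  define W where "W i b = pmf (map_pmf (\<lambda>y. y i) \<mu>) b * of_bool (b \<in> B i)" for i b
  have sub: "set_pmf \<mu> \<subseteq> cube m"
    using assms by (simp add: prod_dists_def)
  have W: "0 \<le> W i b" for i b
    by (simp add: W_def)
  have prob: "measure_pmf.prob \<mu> (subcube m B \<inter> {x. P x}) = wsum {..<m} W (\<lambda>x. of_bool (P x))" for P
    unfolding prob_cube_sum[OF sub] wsum_def cube_def[symmetric]
  proof (intro sum.cong refl)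
    fix x assume x: "x \<in> cube m"
    have "(\<Prod>i<m. of_bool (x i \<in> B i) :: real) = of_bool (x \<in> subcube m B)"
      using x by (auto simp: subcube_def PiE_dflt_def cube_def)
    then show "pmf \<mu> x * of_bool (x \<in> subcube m B \<inter> {x. P x}) = (\<Prod>i<m. W i (x i)) * of_bool (P x)"
      by (simp add: W_def prod.distrib pmf_prod_dists[OF assms x])
  qed
  let ?a = "wsum {..<m} W (\<lambda>x. of_bool (\<not> g x))" and ?b = "wsum {..<m} W (\<lambda>x. of_bool (g x))"
  let ?e = "\<Sum>i | i < m \<and> B i = UNIV. wsum {..<m} W (\<lambda>x. of_bool (sensitive g x i))"
  have tot: "wsum {..<m} W (\<lambda>_. 1) = ?a + ?b"
    unfolding wsum_add[symmetric] by (intro arg_cong[of _ _ "wsum {..<m} W"]) auto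
  \<comment> \<open>Both weights of \<open>i\<close> can be nonzero only if both values are allowed,
    that is, if \<open>B i = UNIV\<close>.\<close>
  have "(\<Sum>i<m. of_bool (W i False * W i True \<noteq> 0) * wsum {..<m} W (\<lambda>x. of_bool (sensitive g x i)))
      \<le> (\<Sum>i<m. if B i = UNIV then wsum {..<m} W (\<lambda>x. of_bool (sensitive g x i)) else 0)"
    by (intro sum_mono) (auto simp: W_def UNIV_bool wsum_nonneg W)
  also have "\<dots> = ?e"
    by (simp add: sum.If_cases Int_def)
  finally have "?b * ?a \<le> (?a + ?b) * ?e"
    using wsum_poincare[of "{..<m}" W g, OF _ W] tot W
    by (smt (verit) finite_lessThan mult_left_mono wsum_nonneg of_bool_def)
  then have "min ?a ?b \<le> 2 * ?e"
    by (intro min_le_of_mult_le sum_nonneg wsum_nonneg W) (auto simp: mult.commute)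
  then show ?thesis
    by (simp add: leaf_mass_def prob Collect_conj_eq)
qed

text \<open>Induction on the tree, over all subcubes at once. A leaf is the Poincare bound for the
  free variables. A query fixes its own variable in both halves, and the terms of all other
  variables split over the halves.\<close>

lemma sum_leaf_mass_subcube_le:
  assumes "\<mu> \<in> prod_dists m" "queried_vars T \<subseteq> {..<m}"
  shows "sum (leaf_mass g \<mu>) (leaves_within (subcube m B) T) \<le>
    2 * (\<Sum>i | i < m \<and> B i = UNIV.
      measure_pmf.prob \<mu> {x \<in> subcube m B. sensitive g x i \<and> i \<notin> path_vars T x})"
  using assms(2)
proof (induction T arbitrary: B)
  case Leaf
  then show ?case
    using leaf_mass_subcube_le[OF assms(1), of g B] by simp
next
  case (Query j T\<^sub>0 T\<^sub>1)
  define C where "C b = B(j := B j \<inter> {b})" for b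
  have j: "j < m"
    using Query.prems by simp
  have C: "subcube m B \<inter> {x. \<not> x j} = subcube m (C False)" "subcube m B \<inter> {x. x j} = subcube m (C True)"
    using j by (auto simp: subcube_def PiE_dflt_def C_def split: if_splits)
  have idx: "{i. i < m \<and> C b i = UNIV} = {i. i < m \<and> B i = UNIV} - {j}" for b
    by (auto simp: C_def UNIV_bool)
  let ?q = "\<lambda>T B i. measure_pmf.prob \<mu> {x \<in> subcube m B. sensitive g x i \<and> i \<notin> path_vars T x}"
  have split: "?q (Query j T\<^sub>0 T\<^sub>1) B i = ?q T\<^sub>0 (C False) i + ?q T\<^sub>1 (C True) i" if "i \<noteq> j" for i
  proof -
    have "{x \<in> subcube m B. sensitive g x i \<and> i \<notin> path_vars (Query j T\<^sub>0 T\<^sub>1) x} =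
      {x \<in> subcube m (C False). sensitive g x i \<and> i \<notin> path_vars T\<^sub>0 x} \<union>
      {x \<in> subcube m (C True). sensitive g x i \<and> i \<notin> path_vars T\<^sub>1 x}"
      using that unfolding C[symmetric] by auto
    moreover have "subcube m (C False) \<inter> subcube m (C True) = {}"
      unfolding C[symmetric] by auto
    ultimately show ?thesis
      by (simp, intro measure_pmf.finite_measure_Union) auto
  qed
  have "sum (leaf_mass g \<mu>) (leaves_within (subcube m B) (Query j T\<^sub>0 T\<^sub>1)) \<le>
    2 * (\<Sum>i\<in>{i. i < m \<and> B i = UNIV} - {j}. ?q T\<^sub>0 (C False) i) +
    2 * (\<Sum>i\<in>{i. i < m \<and> B i = UNIV} - {j}. ?q T\<^sub>1 (C True) i)"
    using Query.IH(1)[of "C False"] Query.IH(2)[of "C True"] Query.prems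
    unfolding sum_leaves_within_Query[of "leaf_mass g \<mu>", OF leaf_mass_empty] C idx by (intro add_mono) auto
  also have "\<dots> = 2 * (\<Sum>i\<in>{i. i < m \<and> B i = UNIV} - {j}. ?q (Query j T\<^sub>0 T\<^sub>1) B i)"
    by (simp add: split sum.distrib del: path_vars.simps)
  also have "\<dots> \<le> 2 * (\<Sum>i | i < m \<and> B i = UNIV. ?q (Query j T\<^sub>0 T\<^sub>1) B i)"
    by (intro mult_left_mono sum_mono2) auto
  finally show ?case .
qed

lemma tree_error_le:
  assumes "\<mu> \<in> prod_dists m" "queried_vars T \<subseteq> {..<m}"
  shows "tree_error m g \<mu> T \<le>
    2 * (\<Sum>x\<in>cube m. pmf \<mu> x * (\<Sum>i<m. of_bool (sensitive g x i \<and> i \<notin> path_vars T x)))"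
proof -
  have sub: "set_pmf \<mu> \<subseteq> cube m"
    using assms by (simp add: prod_dists_def)
  have "tree_error m g \<mu> T \<le> 2 * (\<Sum>i | i < m.
      measure_pmf.prob \<mu> {x \<in> cube m. sensitive g x i \<and> i \<notin> path_vars T x})"
    using sum_leaf_mass_subcube_le[OF assms, of g "\<lambda>_. UNIV"]
    by (simp add: tree_error_eq cube_def subcube_def)
  also have "\<dots> = 2 * (\<Sum>i<m. \<Sum>x\<in>cube m. pmf \<mu> x * of_bool (sensitive g x i \<and> i \<notin> path_vars T x))"
    unfolding prob_cube_sum[OF sub] lessThan_def by (intro arg_cong2[of _ _ _ _ "(*)"] sum.cong) auto
  also have "\<dots> = 2 * (\<Sum>x\<in>cube m. pmf \<mu> x * (\<Sum>i<m. of_bool (sensitive g x i \<and> i \<notin> path_vars T x)))"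
    by (subst sum.swap) (simp add: sum_distrib_left del: sum_of_bool_eq)
  finally show ?thesis .
qed

subsection \<open>Sensitive variables are queried\<close>

text \<open>Makes the support of every randomized tree finite, so that all expectations over it are
  of integrable functions.\<close>

lemma finite_bounded_dtrees:
  assumes "finite V"
  shows "finite {T. depth T \<le> d \<and> queried_vars T \<subseteq> V}"
proof (induction d)
  case 0
  have "{T. depth T \<le> 0 \<and> queried_vars T \<subseteq> V} \<subseteq> {Leaf}"
  proof
    fix T assume "T \<in> {T. depth T \<le> 0 \<and> queried_vars T \<subseteq> V}"
    then show "T \<in> {Leaf}" by (cases T) auto
  qed
  then show ?case
    by (rule finite_subset) simp
next
  case (Suc d)
  let ?D = "{T. depth T \<le> d \<and> queried_vars T \<subseteq> V}"
  have "{T. depth T \<le> Suc d \<and> queried_vars T \<subseteq> V} \<subseteq>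
      insert Leaf ((\<lambda>(i, T\<^sub>0, T\<^sub>1). Query i T\<^sub>0 T\<^sub>1) ` (V \<times> ?D \<times> ?D))"
  proof
    fix T assume "T \<in> {T. depth T \<le> Suc d \<and> queried_vars T \<subseteq> V}"
    then show "T \<in> insert Leaf ((\<lambda>(i, T\<^sub>0, T\<^sub>1). Query i T\<^sub>0 T\<^sub>1) ` (V \<times> ?D \<times> ?D))"
      by (cases T) (auto simp: image_iff)
  qed
  then show ?case
    by (rule finite_subset) (use Suc assms in auto)
qed

lemma depth_le_query_complexity:
  assumes "randomized_dtree m R" "T \<in> set_pmf R"
  shows "depth T \<le> query_complexity R"
  unfolding query_complexity_def using assms
  by (intro Max_ge imageI) (simp_all add: randomized_dtree_def)

lemma finite_set_randomized_dtree:
  assumes "randomized_dtree m R"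
  shows "finite (set_pmf R)"
proof (rule finite_subset)
  show "set_pmf R \<subseteq> {T. depth T \<le> query_complexity R \<and> queried_vars T \<subseteq> {..<m}}"
    using assms depth_le_query_complexity[OF assms] by (auto simp: randomized_dtree_def)
qed (simp add: finite_bounded_dtrees)

lemma expectation_mono_finite:
  fixes f h :: "'a \<Rightarrow> real"
  assumes "finite (set_pmf R)" "\<And>T. T \<in> set_pmf R \<Longrightarrow> f T \<le> h T"
  shows "measure_pmf.expectation R f \<le> measure_pmf.expectation R h"
  using assms by (intro integral_mono_AE integrable_measure_pmf_finite AE_pmfI)

lemma expectation_of_bool: "measure_pmf.expectation R (\<lambda>T. of_bool (P T)) = measure_pmf.prob R {T. P T}"
proof -
  have "(\<lambda>T. of_bool (P T)) = (indicat_real {T. P T})"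
    by (auto simp: indicator_def)
  then show ?thesis
    by simp
qed

lemma finite_path_vars: "finite (path_vars T x)"
  by (induction T) auto

lemma card_path_vars_le: "card (path_vars T x) \<le> depth T"
  by (induction T) (auto simp: card_insert_if finite_path_vars)

text \<open>As \<open>x\<close> and \<open>y\<close> can differ only at \<open>i\<close>, which is
  not queried on \<open>x\<close>, both follow the same path. The leaf they share has mass at least
  1/2 on either value of \<open>g\<close>.\<close>

lemma half_le_sum_leaf_mass:
  assumes "g y \<noteq> g x" "1/2 \<le> pmf \<mu> x" "1/2 \<le> pmf \<mu> y" "\<And>j. j \<noteq> i \<Longrightarrow> y j = x j"
    and "x \<in> S" "y \<in> S" "i \<notin> path_vars T x"
  shows "1/2 \<le> sum (leaf_mass g \<mu>) (leaves_within S T)"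
  using assms(5-7)
proof (induction T arbitrary: S)
  case Leaf
  have le: "1/2 \<le> measure_pmf.prob \<mu> X" if "y \<in> X" "1/2 \<le> pmf \<mu> y" for X y
  proof -
    have "pmf \<mu> y \<le> measure_pmf.prob \<mu> X"
      using that by (simp add: measure_pmf_single[symmetric] measure_pmf.finite_measure_mono)
    with that show ?thesis by simp
  qed
  have "1/2 \<le> measure_pmf.prob \<mu> (S \<inter> {z. \<not> g z}) \<and> 1/2 \<le> measure_pmf.prob \<mu> (S \<inter> {z. g z})"
  proof (cases "g x")
    case True
    with Leaf assms(1) show ?thesis
      by (intro conjI le[OF _ assms(3)] le[OF _ assms(2)]) auto
  next
    case False
    with Leaf assms(1) show ?thesis
      by (intro conjI le[OF _ assms(2)] le[OF _ assms(3)]) auto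
  qed
  then show ?case
    by (simp add: leaf_mass_def)
next
  case (Query j T\<^sub>0 T\<^sub>1)
  have nonneg: "0 \<le> sum (leaf_mass g \<mu>) L" for L
    by (intro sum_nonneg leaf_mass_nonneg)
  have "y j = x j"
    using Query.prems by (intro assms(4)) auto
  show ?case
  proof (cases "x j")
    case True
    then have "1/2 \<le> sum (leaf_mass g \<mu>) (leaves_within (S \<inter> {x. x j}) T\<^sub>1)"
      using Query.prems \<open>y j = x j\<close> by (intro Query.IH(2)) auto
    then show ?thesis
      unfolding sum_leaves_within_Query[of "leaf_mass g \<mu>", OF leaf_mass_empty]
      using nonneg[of "leaves_within (S \<inter> {x. \<not> x j}) T\<^sub>0"] by linarith
  next
    case False
    then have "1/2 \<le> sum (leaf_mass g \<mu>) (leaves_within (S \<inter> {x. \<not> x j}) T\<^sub>0)"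
      using Query.prems \<open>y j = x j\<close> by (intro Query.IH(1)) auto
    then show ?thesis
      unfolding sum_leaves_within_Query[of "leaf_mass g \<mu>", OF leaf_mass_empty]
      using nonneg[of "leaves_within (S \<inter> {x. x j}) T\<^sub>1"] by linarith
  qed
qed

text \<open>Each tree missing \<open>i\<close> on \<open>x\<close> has error at least 1/2 on the
  two-point distribution, so half the probability of a miss is at most
  \<open>1/2 - \<epsilon>\<close>.\<close>

lemma prob_sensitive_unqueried_le:
  assumes R: "randomized_dtree m R" "computes_prod m (1/2 - \<epsilon>) g R"
    and x: "x \<in> cube m" "i < m" "sensitive g x i"
  shows "measure_pmf.prob R {T. i \<notin> path_vars T x} \<le> 1 - 2 * \<epsilon>"
proof -
  \<comment> \<open>A fair coin at \<open>i\<close>, all other bits frozen to those of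
    \<open>x\<close>.\<close>
  define \<mu> where "\<mu> = Pi_pmf {..<m} False (\<lambda>j. if j = i then bernoulli_pmf (1/2) else return_pmf (x j))"
  have "set_pmf \<mu> \<subseteq> cube m"
    unfolding \<mu>_def using set_Pi_pmf_subset[of "{..<m}" False] by (fastforce simp: cube_def PiE_dflt_def)
  then have "\<mu> \<in> prod_dists m"
    unfolding prod_dists_def \<mu>_def by (simp add: indep_vars_Pi_pmf)
  then have err: "measure_pmf.expectation R (tree_error m g \<mu>) \<le> 1/2 - \<epsilon>"
    using R(2) by (simp add: computes_prod_def)
  have xb: "x(i := b) \<in> cube m" for b
    using x by (auto simp: cube_def PiE_dflt_def)
  have half: "pmf \<mu> (x(i := b)) = 1/2" for b
  proof -
    have "pmf \<mu> (x(i := b)) =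
        (\<Prod>j<m. pmf (if j = i then bernoulli_pmf (1/2) else return_pmf (x j)) ((x(i := b)) j))"
      unfolding \<mu>_def using xb by (intro pmf_Pi') (auto simp: cube_def PiE_dflt_def)
    also have "\<dots> = (\<Prod>j<m. if j = i then 1/2 else 1)"
      by (intro prod.cong) auto
    finally show ?thesis
      using x by simp
  qed
  have "1/2 * of_bool (i \<notin> path_vars T x) \<le> tree_error m g \<mu> T" for T
    using half_le_sum_leaf_mass[of g "x(i := \<not> x i)" x \<mu> i "cube m" T] half[of "x i"] half[of "\<not> x i"] x xb
    by (auto simp: tree_error_eq sensitive_def intro!: sum_nonneg leaf_mass_nonneg)
  then have "measure_pmf.expectation R (\<lambda>T. 1/2 * of_bool (i \<notin> path_vars T x)) \<le>
      measure_pmf.expectation R (tree_error m g \<mu>)"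
    by (intro expectation_mono_finite finite_set_randomized_dtree[OF R(1)])
  with err show ?thesis
    by (simp add: expectation_of_bool)
qed

text \<open>Double counting: the query probabilities of the sensitive variables, each at least
  \<open>2 * \<epsilon>\<close>, add up to the expected number of them on the path of
  \<open>x\<close>, which is at most the depth.\<close>

lemma sensitivity_le:
  assumes R: "randomized_dtree m R" "computes_prod m (1/2 - \<epsilon>) g R" and x: "x \<in> cube m"
  shows "2 * \<epsilon> * (\<Sum>i<m. of_bool (sensitive g x i)) \<le> real (query_complexity R)"
proof -
  have fin: "finite (set_pmf R)"
    using R(1) by (rule finite_set_randomized_dtree)
  let ?A = "{i. i < m \<and> sensitive g x i}"
  have "2 * \<epsilon> \<le> measure_pmf.prob R {T. i \<in> path_vars T x}" if "i \<in> ?A" for i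
  proof -
    have "measure_pmf.prob R {T. i \<in> path_vars T x} = 1 - measure_pmf.prob R {T. i \<notin> path_vars T x}"
      using measure_pmf.prob_compl[of "{T. i \<notin> path_vars T x}" R]
      by (simp add: Collect_neg_eq[symmetric] Compl_eq_Diff_UNIV[symmetric])
    with prob_sensitive_unqueried_le[OF R x, of i] that show ?thesis
      by simp
  qed
  then have "(\<Sum>i\<in>?A. 2 * \<epsilon>) \<le> (\<Sum>i\<in>?A. measure_pmf.prob R {T. i \<in> path_vars T x})"
    by (rule sum_mono)
  also have "\<dots> = measure_pmf.expectation R (\<lambda>T. \<Sum>i\<in>?A. of_bool (i \<in> path_vars T x))"
    by (simp add: expectation_of_bool integrable_measure_pmf_finite[OF fin] del: sum_of_bool_eq)
  also have "\<dots> \<le> measure_pmf.expectation R (\<lambda>_. real (query_complexity R))"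
  proof (rule expectation_mono_finite[OF fin])
    fix T assume T: "T \<in> set_pmf R"
    have "card (?A \<inter> path_vars T x) \<le> card (path_vars T x)"
      by (intro card_mono finite_path_vars) auto
    also have "\<dots> \<le> query_complexity R"
      using card_path_vars_le depth_le_query_complexity[OF R(1) T] order_trans by blast
    finally show "(\<Sum>i\<in>?A. of_bool (i \<in> path_vars T x)) \<le> real (query_complexity R)"
      by simp
  qed
  finally show ?thesis
    by (simp add: lessThan_def Collect_conj_eq mult.commute)
qed

subsection \<open>Independent repetition\<close>

text \<open>Runs \<open>T\<close> and then \<open>U\<close>, whatever \<open>T\<close> has seen;
  variables may be queried again, which leaves the two runs independent when \<open>T\<close> and
  \<open>U\<close> are.\<close>

fun graft :: "dtree \<Rightarrow> dtree \<Rightarrow> dtree" where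
  "graft Leaf U = U"
| "graft (Query i T\<^sub>0 T\<^sub>1) U = Query i (graft T\<^sub>0 U) (graft T\<^sub>1 U)"

lemma path_vars_graft: "path_vars (graft T U) x = path_vars T x \<union> path_vars U x"
  by (induction T) auto

lemma depth_graft_le: "depth (graft T U) \<le> depth T + depth U"
  by (induction T) auto

lemma queried_vars_graft: "queried_vars (graft T U) \<subseteq> queried_vars T \<union> queried_vars U"
  by (induction T) auto

primrec repeat_dtree :: "nat \<Rightarrow> dtree pmf \<Rightarrow> dtree pmf" where
  "repeat_dtree 0 R = return_pmf Leaf"
| "repeat_dtree (Suc k) R = map_pmf (\<lambda>(T, U). graft T U) (pair_pmf R (repeat_dtree k R))"

lemma depth_repeat_dtree_le:
  assumes "randomized_dtree m R" "T \<in> set_pmf (repeat_dtree k R)"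
  shows "depth T \<le> k * query_complexity R"
  using assms(2)
proof (induction k arbitrary: T)
  case (Suc k)
  then obtain U V where UV: "U \<in> set_pmf R" "V \<in> set_pmf (repeat_dtree k R)" "T = graft U V"
    by auto
  have "depth T \<le> depth U + depth V"
    by (simp add: UV depth_graft_le)
  with Suc.IH[OF UV(2)] depth_le_query_complexity[OF assms(1) UV(1)] show ?case
    by simp
qed simp

lemma randomized_repeat_dtree:
  assumes "randomized_dtree m R"
  shows "randomized_dtree m (repeat_dtree k R)"
proof -
  have "queried_vars T \<subseteq> {..<m}" if "T \<in> set_pmf (repeat_dtree k R)" for T
    using that
  proof (induction k arbitrary: T)
    case (Suc k)
    then obtain U V where UV: "U \<in> set_pmf R" "V \<in> set_pmf (repeat_dtree k R)" "T = graft U V"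
      by auto
    with Suc.IH[OF UV(2)] assms queried_vars_graft[of U V] show ?case
      unfolding randomized_dtree_def by blast
  qed simp
  moreover have "depth ` set_pmf (repeat_dtree k R) \<subseteq> {..k * query_complexity R}"
    using depth_repeat_dtree_le[OF assms] by auto
  then have "finite (depth ` set_pmf (repeat_dtree k R))"
    by (rule finite_subset) simp
  ultimately show ?thesis
    by (simp add: randomized_dtree_def)
qed

lemma query_complexity_repeat_dtree_le:
  assumes "randomized_dtree m R"
  shows "query_complexity (repeat_dtree k R) \<le> k * query_complexity R"
proof -
  have "finite (depth ` set_pmf (repeat_dtree k R))"
    using randomized_repeat_dtree[OF assms, of k] by (simp add: randomized_dtree_def)
  then show ?thesis
    unfolding query_complexity_def[of "repeat_dtree k R"]
    by (rule Max.boundedI) (auto simp: set_pmf_not_empty intro: depth_repeat_dtree_le[OF assms])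
qed

lemma prob_pair_pmf_Times:
  "measure_pmf.prob (pair_pmf M N) (A \<times> B) = measure_pmf.prob M A * measure_pmf.prob N B"
proof -
  \<comment> \<open>Cutting down to the supports makes both sets countable.\<close>
  have "measure_pmf.prob (pair_pmf M N) (A \<times> B) =
      measure_pmf.prob (pair_pmf M N) ((A \<inter> set_pmf M) \<times> (B \<inter> set_pmf N))"
    by (subst measure_Int_set_pmf[symmetric]) (simp add: Times_Int_Times)
  then show ?thesis
    by (simp add: measure_pmf_prob_product countable_Int2 measure_Int_set_pmf)
qed

text \<open>A variable is missed exactly when each of the \<open>k\<close> independent runs misses
  it.\<close>

lemma prob_unqueried_repeat_dtree:
  "measure_pmf.prob (repeat_dtree k R) {T. i \<notin> path_vars T x} =
    measure_pmf.prob R {T. i \<notin> path_vars T x} ^ k"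
proof (induction k)
  case (Suc k)
  have "(\<lambda>(T, U). graft T U) -` {T. i \<notin> path_vars T x} =
      {T. i \<notin> path_vars T x} \<times> {T. i \<notin> path_vars T x}"
    by (auto simp: path_vars_graft)
  with Suc show ?case
    by (simp add: prob_pair_pmf_Times)
qed simp

lemma computes_prod_repeat_dtree:
  assumes R: "randomized_dtree m R" "computes_prod m (1/2 - \<epsilon>) g R" and "0 < \<epsilon>"
    and "\<epsilon> < 1/2" and k: "real (query_complexity R) / \<epsilon> * (1 - 2 * \<epsilon>) ^ k \<le> \<delta>"
  shows "computes_prod m \<delta> g (repeat_dtree k R)"
  unfolding computes_prod_def
proof
  fix \<mu> assume \<mu>: "\<mu> \<in> prod_dists m"
  let ?R = "repeat_dtree k R"
  let ?d = "real (query_complexity R)"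
  have fin: "finite (set_pmf ?R)"
    using R(1) by (intro finite_set_randomized_dtree randomized_repeat_dtree)
  have "measure_pmf.expectation ?R (tree_error m g \<mu>) \<le> measure_pmf.expectation ?R (\<lambda>T.
      2 * (\<Sum>x\<in>cube m. pmf \<mu> x * (\<Sum>i<m. of_bool (sensitive g x i) * of_bool (i \<notin> path_vars T x))))"
    using tree_error_le[OF \<mu>, of _ g] randomized_repeat_dtree[OF R(1), of k]
    by (intro expectation_mono_finite[OF fin]) (simp add: randomized_dtree_def of_bool_conj)
  also have "\<dots> = 2 * (\<Sum>x\<in>cube m. pmf \<mu> x *
      (\<Sum>i<m. of_bool (sensitive g x i) * measure_pmf.prob ?R {T. i \<notin> path_vars T x}))"
    by (simp add: expectation_of_bool integrable_measure_pmf_finite[OF fin]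
        del: sum_of_bool_eq sum_mult_of_bool_eq sum_of_bool_mult_eq)
  \<comment> \<open>At most \<open>?d / (2 * \<epsilon>)\<close> variables are sensitive at
    \<open>x\<close>, and each is missed by all runs with probability at most
    \<open>(1 - 2 * \<epsilon>) ^ k\<close>.\<close>
  also have "\<dots> \<le> 2 * (\<Sum>x\<in>cube m. pmf \<mu> x * (?d / (2 * \<epsilon>) * (1 - 2 * \<epsilon>) ^ k))"
  proof (intro mult_left_mono sum_mono)
    fix x assume x: "x \<in> cube m"
    have "(\<Sum>i<m. of_bool (sensitive g x i) * measure_pmf.prob ?R {T. i \<notin> path_vars T x}) \<le>
        (\<Sum>i<m. of_bool (sensitive g x i) * (1 - 2 * \<epsilon>) ^ k)"
      unfolding prob_unqueried_repeat_dtree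
      using prob_sensitive_unqueried_le[OF R x] by (intro sum_mono) (auto intro!: power_mono)
    also have "\<dots> = (\<Sum>i<m. of_bool (sensitive g x i)) * (1 - 2 * \<epsilon>) ^ k"
      by (simp add: sum_distrib_right)
    also have "\<dots> \<le> ?d / (2 * \<epsilon>) * (1 - 2 * \<epsilon>) ^ k"
      using sensitivity_le[OF R x] assms(3,4)
      by (intro mult_right_mono) (auto simp: field_simps)
    finally show "(\<Sum>i<m. of_bool (sensitive g x i) * measure_pmf.prob ?R {T. i \<notin> path_vars T x}) \<le>
      ?d / (2 * \<epsilon>) * (1 - 2 * \<epsilon>) ^ k" .
  qed auto
  also have "\<dots> = 2 * (?d / (2 * \<epsilon>) * (1 - 2 * \<epsilon>) ^ k)"
    using \<mu> by (simp only: sum_distrib_right[symmetric] prod_dists_def mem_Collect_eq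
      sum_pmf_eq_1[OF finite_cube] mult_1_left)
  also have "\<dots> \<le> \<delta>"
    using k by simp
  finally show "measure_pmf.expectation ?R (tree_error m g \<mu>) \<le> \<delta>" .
qed

section \<open>Attaining the minimum, and the number of repetitions\<close>

fun full_dtree :: "nat \<Rightarrow> dtree" where
  "full_dtree 0 = Leaf"
| "full_dtree (Suc n) = Query n (full_dtree n) (full_dtree n)"

lemma path_vars_full_dtree: "path_vars (full_dtree n) x = {..<n}"
  by (induction n) (simp_all add: lessThan_Suc)

lemma queried_vars_full_dtree: "queried_vars (full_dtree n) = {..<n}"
  by (induction n) (simp_all add: lessThan_Suc)

text \<open>The tree querying every variable leaves no sensitive variable unqueried and so has error
  0; hence the least depth is taken over a nonempty set.\<close>

lemma R_prod_err_attained: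
  assumes "0 \<le> \<delta>"
  obtains R where "randomized_dtree m R" "computes_prod m \<delta> g R" "query_complexity R = R_prod_err m \<delta> g"
proof -
  have rand: "randomized_dtree m (return_pmf (full_dtree m))"
    by (simp add: randomized_dtree_def queried_vars_full_dtree)
  have "tree_error m g \<mu> (full_dtree m) \<le> 0" if "\<mu> \<in> prod_dists m" for \<mu>
    using tree_error_le[OF that, of "full_dtree m" g]
    by (simp add: queried_vars_full_dtree path_vars_full_dtree del: sum_of_bool_eq)
  then have "computes_prod m \<delta> g (return_pmf (full_dtree m))"
    using assms by (force simp: computes_prod_def)
  with rand have "\<exists>d R. randomized_dtree m R \<and> computes_prod m \<delta> g R \<and> query_complexity R = d"
    by blast
  from LeastI_ex[OF this] show ?thesis
    using that unfolding R_prod_err_def by blast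
qed

lemma R_prod_err_le:
  assumes "randomized_dtree m R" "computes_prod m \<delta> g R"
  shows "R_prod_err m \<delta> g \<le> query_complexity R"
  unfolding R_prod_err_def by (rule Least_le) (use assms in blast)

text \<open>\<open>k\<close> is chosen so that \<open>exp (- (2 * \<epsilon> * k))\<close>, which
  dominates \<open>(1 - 2 * \<epsilon>) ^ k\<close>, is at most \<open>1 / (3 * h)\<close>.\<close>

lemma repetitions_suffice:
  fixes d :: nat and \<epsilon> :: real
  assumes "0 < \<epsilon>" "\<epsilon> < 1/2" "1 \<le> d"
  defines "h \<equiv> real d / \<epsilon>"
  defines "k \<equiv> nat \<lceil>ln (3 * h) / (2 * \<epsilon>)\<rceil>"
  shows "h * (1 - 2 * \<epsilon>) ^ k \<le> 1/3" "real (k * d) \<le> 2 * (h * log 2 (2 + h))"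
proof -
  \<comment> \<open>From \<open>\<epsilon> < 1/2\<close>, \<open>h\<close> is at least
    \<open>2 * d\<close>: this keeps the logarithm nonnegative and later absorbs the extra
    \<open>d\<close> from rounding \<open>k\<close> up.\<close>
  have "real d * (2 * \<epsilon>) \<le> real d * 1"
    using assms(2) by (intro mult_left_mono) auto
  then have h: "2 * real d \<le> h"
    using assms(1) by (simp add: h_def pos_le_divide_eq mult_ac)
  then have h2: "2 \<le> h"
    using assms(3) by linarith
  have k1: "ln (3 * h) / (2 * \<epsilon>) \<le> real k"
    unfolding k_def by linarith
  have "(1 - 2 * \<epsilon>) ^ k \<le> exp (- 2 * \<epsilon>) ^ k"
    using assms(1-3) exp_ge_add_one_self[of "- 2 * \<epsilon>"] by (intro power_mono) auto
  also have "\<dots> = exp (- (2 * \<epsilon> * real k))"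
    by (simp add: exp_of_nat_mult[symmetric] mult_ac)
  also have "\<dots> \<le> exp (- ln (3 * h))"
    using k1 assms(1) by (simp add: pos_divide_le_eq mult.commute)
  also have "\<dots> = 1 / (3 * h)"
    using h2 by (simp add: exp_minus inverse_eq_divide)
  finally show "h * (1 - 2 * \<epsilon>) ^ k \<le> 1/3"
    using h2 by (simp add: field_simps)
  have "0 \<le> ln (3 * h)"
    using h2 by (intro ln_ge_zero) auto
  then have "0 \<le> ln (3 * h) / (2 * \<epsilon>)"
    using assms(1-3) by simp
  then have "real k \<le> ln (3 * h) / (2 * \<epsilon>) + 1"
    unfolding k_def by linarith
  then have "real k * real d \<le> (ln (3 * h) / (2 * \<epsilon>) + 1) * real d"
    by (intro mult_right_mono) auto
  also have "\<dots> = h * (ln (3 * h) / 2) + real d"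
    using assms(1) by (simp add: h_def field_simps)
  finally have kd: "real (k * d) \<le> h * (ln (3 * h) / 2) + real d"
    by simp
  \<comment> \<open>Squaring costs a factor 2 in the logarithm, which the 2 in the denominator of
    \<open>k\<close> pays for.\<close>
  have "3 * h \<le> (2 + h)\<^sup>2"
    using h2 by (simp add: power2_eq_square algebra_simps)
  then have "ln (3 * h) \<le> ln ((2 + h)\<^sup>2)"
    using h2 by (subst ln_le_cancel_iff) auto
  also have "\<dots> = 2 * ln (2 + h)"
    using h2 by (simp add: ln_realpow)
  finally have "ln (3 * h) / 2 \<le> ln (2 + h)"
    by simp
  also have "\<dots> \<le> log 2 (2 + h)"
  proof -
    have "0 \<le> ln (2 + h)" using h2 by simp
    moreover have "0 < ln (2::real)" "ln (2::real) \<le> 1"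
      using ln_le_minus_one[of "2::real"] by auto
    ultimately show ?thesis
      by (simp add: log_def field_simps mult_left_le_one_le)
  qed
  finally have 1: "h * (ln (3 * h) / 2) \<le> h * log 2 (2 + h)"
    using h2 by (intro mult_left_mono) auto
  have "1 \<le> log 2 (2 + h)"
    using h2 by simp
  then have "h * 1 \<le> h * log 2 (2 + h)"
    using h2 by (intro mult_left_mono) auto
  with 1 kd h show "real (k * d) \<le> 2 * (h * log 2 (2 + h))"
    by linarith
qed

theorem theorem3:
  "soft_O_on {(m :: nat, g :: (nat \<Rightarrow> bool) \<Rightarrow> bool, \<epsilon> :: nat \<Rightarrow> real). \<forall>n. 0 < \<epsilon> n \<and> \<epsilon> n < 1/2}
     (\<lambda>(m, g, \<epsilon>). real (R_prod m g))
     (\<lambda>(m, g, \<epsilon>). 1 / \<epsilon> m * real (R_prod_err m (1/2 - \<epsilon> m) g))"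
proof -
  have "real (R_prod m g) \<le> 2 * (h * log 2 (2 + h))"
    if \<epsilon>: "0 < \<epsilon>" "\<epsilon> < 1/2" and h: "h = 1 / \<epsilon> * real (R_prod_err m (1/2 - \<epsilon>) g)"
    for m g and \<epsilon> h :: real
  proof -
    obtain R where R: "randomized_dtree m R" "computes_prod m (1/2 - \<epsilon>) g R"
      "query_complexity R = R_prod_err m (1/2 - \<epsilon>) g"
      by (rule R_prod_err_attained[of "1/2 - \<epsilon>" m g]) (use \<epsilon> in simp)
    define d where "d = query_complexity R"
    have hd: "h = real d / \<epsilon>"
      by (simp add: h d_def R(3))
    have upper: "R_prod m g \<le> k * d" if "h * (1 - 2 * \<epsilon>) ^ k \<le> 1/3" for k
    proof -
      have "computes_prod m (1/3) g (repeat_dtree k R)"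
        using that hd \<epsilon> by (intro computes_prod_repeat_dtree[OF R(1,2)]) (simp_all add: d_def)
      then have "R_prod m g \<le> query_complexity (repeat_dtree k R)"
        unfolding R_prod_def by (intro R_prod_err_le randomized_repeat_dtree R)
      also have "\<dots> \<le> k * d"
        unfolding d_def by (rule query_complexity_repeat_dtree_le[OF R(1)])
      finally show ?thesis .
    qed
    show ?thesis
    \<comment> \<open>For \<open>d = 0\<close> also \<open>h = 0\<close>, the logarithm in the
      choice of \<open>k\<close> is of no use, and zero repetitions already meet the error
      condition.\<close>
    proof (cases "d = 0")
      case True
      with upper[of 0] hd show ?thesis
        by simp
    next
      case False
      then have "1 \<le> d" by simp
      note rep = repetitions_suffice[OF \<epsilon> this, folded hd]
      from upper[OF rep(1)] rep(2) show ?thesis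
        by (meson of_nat_mono order_trans)
    qed
  qed
  note bound = this
  show ?thesis
    unfolding soft_O_on_def
  \<comment> \<open>One logarithmic factor and the constant 2 suffice, uniformly in
    \<open>m\<close>, \<open>g\<close> and \<open>\<epsilon>\<close>.\<close>
  proof (intro exI[of _ "2::real"] conjI exI[of _ "1::nat"] ballI)
    fix a :: "nat \<times> ((nat \<Rightarrow> bool) \<Rightarrow> bool) \<times> (nat \<Rightarrow> real)"
    assume a: "a \<in> {(m, g, \<epsilon>). \<forall>n. 0 < \<epsilon> n \<and> \<epsilon> n < 1/2}"
    obtain m g \<epsilon> where eq: "a = (m, g, \<epsilon>)"
      by (cases a)
    with a have "0 < \<epsilon> m" "\<epsilon> m < 1/2"
      by auto
    from bound[OF this refl, of m g] this
    show "\<bar>(\<lambda>(m, g, \<epsilon>). real (R_prod m g)) a\<bar> \<le>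
        2 * (\<bar>(\<lambda>(m, g, \<epsilon>). 1 / \<epsilon> m * real (R_prod_err m (1/2 - \<epsilon> m) g)) a\<bar> *
          log 2 (2 + \<bar>(\<lambda>(m, g, \<epsilon>). 1 / \<epsilon> m * real (R_prod_err m (1/2 - \<epsilon> m) g)) a\<bar>) ^ 1)"
      by (simp add: eq)
  qed simp
qed

end
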